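(* Let $p=(2143,R)$ with $R=([4]\times\{0\})\cup([4]\times\{4\})\cup(\{4\}\times[4])$ (the bottom row, top row and rightmost column of boxes shaded). Then for every $n\ge4$, \[ s_n^+(p)=(n-2)!\left[\frac{(n-2)(n-3)}{2}-\sum_{k=2}^{n-2}\frac{n-k-1}{k}\right]\qquad\text{and}\qquad\lim_{n\to\infty}\frac{s_n^+(p)}{n!}=\frac12. \]
   Context: For $n\ge1$, $S_n$ is the set of permutations of $\{1,\dots,n\}$ in one-line notation $\tau=\tau_1\cdots\tau_n$. For an integer $k\ge0$ write $[k]=\{0,1,\dots,k\}$. A mesh pattern of length $k$ is a pair $(\pi,R)$ with $\pi\in S_k$ and $R\subseteq[k]\times[k]$; the elements $(x,y)\in R$ are the shaded boxes (box $(x,y)$ is the unit square with south-west corner $(x,y)$ in the plot of the points $(i,\pi_i)$). An occurrence of $(\pi,R)$ in $\tau\in S_n$ is a choice of positions $i_1<\dots<i_k$ such that $\tau_{i_a}<\tau_{i_b}$ iff $\pi_a<\pi_b$ for all $a,b$, and such that for every $(x,y)\in R$ there is no index $m$ with $i_x<m<i_{x+1}$ and $v_y<\tau_m<v_{y+1}$, where $i_0=0$, $i_{k+1}=n+1$, $v_0=0$, $v_{k+1}=n+1$, and for $1\le y\le k$, $v_y$ is the $y$-th smallest of the values $\tau_{i_1},\dots,\tau_{i_k}$. A permutation contains a mesh pattern if it has at least one occurrence of it, and $s_n^+(p)$ denotes the number of permutations in $S_n$ containing $p$. *)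

theory Defs
  imports Complex_Main "HOL-Combinatorics.Multiset_Permutations"
begin

text \<open>
  Permutations are lists in one-line notation. Positions are numbered from 1, whereas list indexing
  starts at 0, so the entry at position \<open>m\<close> of \<open>\<tau>\<close> is \<open>\<tau> ! (m - 1)\<close>.
\<close>

definition perms :: "nat \<Rightarrow> nat list set" where
  "perms n = permutations_of_set {1..n}"

abbreviation entry :: "nat list \<Rightarrow> nat \<Rightarrow> nat" where
  "entry \<tau> m \<equiv> \<tau> ! (m - 1)"

type_synonym mesh_pattern = "nat list \<times> (nat \<times> nat) set"

definition is_mesh_pattern :: "mesh_pattern \<Rightarrow> bool" where
  "is_mesh_pattern p \<longleftrightarrow>
     (case p of (\<pi>, R) \<Rightarrow> \<pi> \<in> perms (length \<pi>) \<and> R \<subseteq> {0..length \<pi>} \<times> {0..length \<pi>})"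

text \<open>
  The list \<open>ps\<close> holds the positions \<open>i\<^sub>1 < \<dots> < i\<^sub>k\<close> of an occurrence. The lists \<open>i\<close> and \<open>v\<close> below
  include the boundary values, so that \<open>i ! x\<close> is \<open>i\<^sub>x\<close> and \<open>v ! y\<close> is \<open>v\<^sub>y\<close> for all indices from \<open>0\<close>
  to \<open>k + 1\<close>. An index \<open>m\<close> with \<open>i\<^sub>x < m < i\<^sub>x\<^sub>+\<^sub>1\<close> automatically lies in \<open>{1..n}\<close>.
\<close>

definition is_occurrence :: "mesh_pattern \<Rightarrow> nat list \<Rightarrow> nat list \<Rightarrow> bool" where
  "is_occurrence p \<tau> ps \<longleftrightarrow>
     (case p of (\<pi>, R) \<Rightarrow>
        let k = length \<pi>; n = length \<tau>;
            vals = map (entry \<tau>) ps;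
            i = 0 # ps @ [n + 1];
            v = 0 # sort vals @ [n + 1]
        in length ps = k \<and> sorted_wrt (<) ps \<and> set ps \<subseteq> {1..n} \<and>
           (\<forall>a<k. \<forall>b<k. vals ! a < vals ! b \<longleftrightarrow> \<pi> ! a < \<pi> ! b) \<and>
           (\<forall>(x, y)\<in>R. \<not> (\<exists>m. i ! x < m \<and> m < i ! (x + 1) \<and>
                              v ! y < entry \<tau> m \<and> entry \<tau> m < v ! (y + 1))))"

definition contains :: "nat list \<Rightarrow> mesh_pattern \<Rightarrow> bool" where
  "contains \<tau> p \<longleftrightarrow> (\<exists>ps. is_occurrence p \<tau> ps)"

definition s_plus :: "nat \<Rightarrow> mesh_pattern \<Rightarrow> nat" where
  "s_plus n p = card {\<tau> \<in> perms n. contains \<tau> p}"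

definition p2143 :: mesh_pattern where
  "p2143 = ([2, 1, 4, 3], {0..4} \<times> {0} \<union> {0..4} \<times> {4} \<union> {4} \<times> {0..4})"

lemma is_mesh_pattern_p2143: "is_mesh_pattern p2143"
  by (auto simp: is_mesh_pattern_def p2143_def perms_def permutations_of_set_def)

end

theory Submission
  imports Defs "HOL-Analysis.Harmonic_Numbers"
begin

text \<open>
  The shading forces the four entries of an occurrence to be \<open>a, 1, n, b\<close> with \<open>b\<close> the last entry of
  the permutation. For a fixed last entry \<open>1 < b < n\<close>, the remaining entries \<open>xs\<close> are therefore good
  iff \<open>1\<close> comes before \<open>n\<close> but some \<open>a < b\<close> comes before \<open>1\<close>, that is, iff \<open>1\<close> is the first among
  \<open>{1, n}\<close> but not among \<open>{1, \<dots>, b - 1, n}\<close>. By symmetry each of the elements of a set \<open>B\<close> is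
  equally often the first one, so there are \<open>(n - 1)! (1/2 - 1/b)\<close> good arrangements. Summing over \<open>b\<close>
  gives \<open>(n - 1)! (n/2 - H\<^sub>n\<^sub>-\<^sub>1)\<close> with \<open>H\<close> the harmonic numbers.
\<close>

section \<open>The first entry of a list that falls into a given set, and its
  equidistribution\<close>

text \<open>Membership of \<open>x\<close> in \<open>B\<close> is left out of the body, which makes
  the predicate antitone in \<open>B\<close> without side conditions; uniqueness of the first
  element adds it back.\<close>

definition first_among :: "'a set \<Rightarrow> 'a \<Rightarrow> 'a list \<Rightarrow> bool" where
  "first_among B x xs \<longleftrightarrow> (\<exists>i<length xs. xs ! i = x \<and> (\<forall>j<i. xs ! j \<notin> B))"

lemma first_among_unique:
  assumes "first_among B x xs" "first_among B y xs" "x \<in> B" "y \<in> B"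
  shows "x = y"
  using assms unfolding first_among_def by (metis linorder_neqE_nat)

lemma first_among_mono:
  assumes "first_among C x xs" "B \<subseteq> C"
  shows "first_among B x xs"
  using assms unfolding first_among_def by blast

lemma ex_first_among:
  assumes "B \<inter> set xs \<noteq> {}"
  shows "\<exists>x\<in>B. first_among B x xs"
proof -
  define i where "i = (LEAST i. i < length xs \<and> xs ! i \<in> B)"
  have ex: "\<exists>i. i < length xs \<and> xs ! i \<in> B"
    using assms by (auto simp: in_set_conv_nth)
  have i: "i < length xs \<and> xs ! i \<in> B"
    unfolding i_def by (rule LeastI_ex[OF ex])
  have "xs ! j \<notin> B" if "j < i" for j
    using not_less_Least[OF that[unfolded i_def]] that i by auto
  then show ?thesis
    using i unfolding first_among_def by blast
qed

lemma first_among_map: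
  assumes "inj f"
  shows "first_among (f ` B) (f x) (map f xs) \<longleftrightarrow> first_among B x xs"
  using assms unfolding first_among_def
  by (auto simp: inj_image_mem_iff inj_eq cong: conj_cong)

lemma permutations_of_set_map:
  assumes "f permutes A" "xs \<in> permutations_of_set A"
  shows "map f xs \<in> permutations_of_set A"
  using assms
  by (auto simp: permutations_of_set_def distinct_map permutes_image permutes_inj_on)

text \<open>Renaming entries by the transposition of \<open>x\<close> and \<open>y\<close> permutes
  \<open>A\<close>, fixes \<open>B\<close> as a set and turns a list led by \<open>x\<close> into
  one led by \<open>y\<close>. Exchanging the roles of \<open>x\<close> and \<open>y\<close> gives
  equality.\<close>

lemma card_first_among_le:
  assumes "finite A" "B \<subseteq> A" "x \<in> B" "y \<in> B"
  shows "card {xs \<in> permutations_of_set A. first_among B x xs}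
           \<le> card {xs \<in> permutations_of_set A. first_among B y xs}"
proof (rule card_inj_on_le)
  let ?f = "Transposition.transpose x y"
  have B: "?f ` B = B"
    using assms(3,4) by (intro permutes_image permutes_swap_id)
  have A: "?f permutes A"
    using assms(2-4) by (intro permutes_swap_id) auto
  show "inj_on (map ?f) {xs \<in> permutations_of_set A. first_among B x xs}"
    by (auto intro!: inj_onI dest: map_injective)
  show "map ?f ` {xs \<in> permutations_of_set A. first_among B x xs}
          \<subseteq> {xs \<in> permutations_of_set A. first_among B y xs}"
    using first_among_map[of ?f B x] B permutations_of_set_map[OF A] by auto
  show "finite {xs \<in> permutations_of_set A. first_among B y xs}"
    by simp
qed

text \<open>Exactly one element of \<open>B\<close> comes first in each arrangement of
  \<open>A\<close>, so the arrangements split into \<open>card B\<close> classes, all of the same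
  size by symmetry.\<close>

lemma card_first_among:
  assumes "finite A" "B \<subseteq> A" "x \<in> B"
  shows "card B * card {xs \<in> permutations_of_set A. first_among B x xs} = fact (card A)"
proof -
  let ?F = "\<lambda>y. {xs \<in> permutations_of_set A. first_among B y xs}"
  have fin: "finite B"
    using assms finite_subset by blast
  have "permutations_of_set A = (\<Union>y\<in>B. ?F y)"
    using ex_first_among[of B] assms by (auto simp: permutations_of_set_def)
  then have "fact (card A) = card (\<Union>y\<in>B. ?F y)"
    using assms by (metis card_permutations_of_set)
  also have "\<dots> = (\<Sum>y\<in>B. card (?F y))"
    using fin by (intro card_UN_disjoint) (auto dest: first_among_unique)
  also have "\<dots> = (\<Sum>y\<in>B. card (?F x))"
    by (intro sum.cong refl antisym card_first_among_le) (use assms in auto)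
  finally show ?thesis
    by simp
qed

section \<open>Occurrences of the mesh pattern\<close>

lemma sort_2143:
  fixes a b c d :: nat
  assumes "b < a" "a < d" "d < c"
  shows "sort [a, b, c, d] = [b, a, d, c]"
  using assms by simp

lemma perms_entry_ex:
  assumes "\<tau> \<in> perms n" "v \<in> {1..n}"
  obtains m where "m \<in> {1..n}" "entry \<tau> m = v"
proof -
  have "v \<in> set \<tau>" "length \<tau> = n"
    using assms by (auto simp: perms_def permutations_of_set_def distinct_card[symmetric])
  then obtain i where "i < n" "\<tau> ! i = v"
    by (auto simp: in_set_conv_nth)
  then show ?thesis
    using that[of "Suc i"] by auto
qed

lemma perms_entry:
  assumes "\<tau> \<in> perms n" "m \<in> {1..n}"
  shows "entry \<tau> m \<in> {1..n}"
proof -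
  have "length \<tau> = n" "set \<tau> = {1..n}"
    using assms by (auto simp: perms_def permutations_of_set_def distinct_card[symmetric])
  then show ?thesis
    using assms nth_mem[of "m - 1" \<tau>] by auto
qed

lemma perms_length: "\<tau> \<in> perms n \<Longrightarrow> length \<tau> = n"
  by (auto simp: perms_def permutations_of_set_def distinct_card[symmetric])

text \<open>The shaded bottom row forces the smallest chosen value to be 1, the top row forces the
  largest to be \<open>n\<close>, and the right column forces the last chosen position to be
  \<open>n\<close>. Conversely, these choices leave all shaded boxes empty.\<close>

lemma contains_p2143_iff:
  assumes "\<tau> \<in> perms n"
  shows "contains \<tau> p2143 \<longleftrightarrow>
    (\<exists>i j k. 1 \<le> i \<and> i < j \<and> j < k \<and> k < n \<and>
       entry \<tau> j = 1 \<and> entry \<tau> k = n \<and> 1 < entry \<tau> i \<and> entry \<tau> i < entry \<tau> n \<and> entry \<tau> n < n)"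
    (is "_ \<longleftrightarrow> ?R")
proof
  have len: "length \<tau> = n"
    using assms by (rule perms_length)
  assume "contains \<tau> p2143"
  then obtain ps where occ: "is_occurrence p2143 \<tau> ps"
    unfolding contains_def by blast
  then have "length ps = 4"
    by (simp add: is_occurrence_def p2143_def Let_def)
  then obtain i j k l where ps: "ps = [i, j, k, l]"
    by (auto simp: numeral_eq_Suc length_Suc_conv)
  let ?e = "entry \<tau>"
  have O: "sorted_wrt (<) ps" "set ps \<subseteq> {1..n}"
    "\<forall>a<length [2,1,4,3::nat]. \<forall>b<length [2,1,4,3::nat].
       map ?e ps ! a < map ?e ps ! b \<longleftrightarrow> [2,1,4,3::nat] ! a < [2,1,4,3] ! b"
    "\<forall>(x, y)\<in>snd p2143. \<not> (\<exists>m. (0 # ps @ [n + 1]) ! x < m \<and> m < (0 # ps @ [n + 1]) ! (x + 1) \<and>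
       (0 # sort (map ?e ps) @ [n + 1]) ! y < ?e m \<and>
       ?e m < (0 # sort (map ?e ps) @ [n + 1]) ! (y + 1))"
    using occ unfolding is_occurrence_def p2143_def Let_def prod.case len snd_conv by blast+
  have pos: "1 \<le> i" "i < j" "j < k" "k < l" "l \<le> n"
    using O(1,2) by (auto simp: ps)
  have mesh: False
    if "(x, y) \<in> snd p2143" "(0 # ps @ [n + 1]) ! x < m" "m < (0 # ps @ [n + 1]) ! (x + 1)"
      "(0 # sort (map ?e ps) @ [n + 1]) ! y < ?e m"
      "?e m < (0 # sort (map ?e ps) @ [n + 1]) ! (y + 1)" for x y m
    using O(4) that by blast
  \<comment> \<open>The three 0-based index pairs run through the neighbouring pattern values 1 < 2,
    2 < 3 and 3 < 4.\<close>
  have vals: "?e j < ?e i" "?e i < ?e l" "?e l < ?e k"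
    using O(3)[rule_format, of 1 0] O(3)[rule_format, of 0 3] O(3)[rule_format, of 3 2]
    by (simp_all add: ps numeral_eq_Suc)
  have sorted: "sort (map ?e ps) = [?e j, ?e i, ?e l, ?e k]"
    using sort_2143[OF vals] by (simp add: ps)
  \<comment> \<open>Each unchosen position lies in some column; where a whole row is shaded, the
    column does not matter.\<close>
  have gap: "\<exists>x\<le>4. (0 # ps @ [n + 1]) ! x < m \<and> m < (0 # ps @ [n + 1]) ! (x + 1)"
    if m: "m \<in> {1..n}" "m \<notin> {i, j, k, l}" for m
  proof -
    consider "m < i" | "i < m" "m < j" | "j < m" "m < k" | "k < m" "m < l" | "l < m"
      using m(2) by (metis insert_iff linorder_neqE_nat)
    then show ?thesis
    proof cases
      case 1 with m show ?thesis by (intro exI[of _ 0]) (auto simp: ps)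
    next
      case 2 then show ?thesis by (intro exI[of _ 1]) (auto simp: ps)
    next
      case 3 then show ?thesis by (intro exI[of _ 2]) (auto simp: ps)
    next
      case 4 then show ?thesis by (intro exI[of _ 3]) (auto simp: ps)
    next
      case 5 with m show ?thesis by (intro exI[of _ 4]) (auto simp: ps)
    qed
  qed
  have rng: "?e i \<in> {1..n}" "?e j \<in> {1..n}" "?e k \<in> {1..n}" "?e l \<in> {1..n}"
    using pos by (intro perms_entry[OF assms]; auto)+
  have ej: "?e j = 1"
  proof (rule ccontr)
    assume ne: "?e j \<noteq> 1"
    obtain m where m: "m \<in> {1..n}" "?e m = 1"
      using perms_entry_ex[OF assms, of 1] rng by auto
    have "m \<notin> {i, j, k, l}"
      using m ne rng vals by auto
    then obtain x where "x \<le> 4" "(0 # ps @ [n + 1]) ! x < m" "m < (0 # ps @ [n + 1]) ! (x + 1)"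
      using gap m by blast
    \<comment> \<open>If \<open>?e j\<close> exceeds 1, the value 1 lies strictly between 0 and
      \<open>?e j\<close>, hence in the bottom row.\<close>
    then show False
      using mesh[of x 0 m] m ne rng unfolding sorted by (auto simp: p2143_def)
  qed
  have ek: "?e k = n"
  proof (rule ccontr)
    assume ne: "?e k \<noteq> n"
    obtain m where m: "m \<in> {1..n}" "?e m = n"
      using perms_entry_ex[OF assms, of n] rng by auto
    have "m \<notin> {i, j, k, l}"
      using m ne rng vals by auto
    then obtain x where "x \<le> 4" "(0 # ps @ [n + 1]) ! x < m" "m < (0 # ps @ [n + 1]) ! (x + 1)"
      using gap m by blast
    then show False
      using mesh[of x 4 m] m ne rng unfolding sorted by (auto simp: p2143_def)
  qed
  have "l = n"
  proof (rule ccontr)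
    assume ne: "l \<noteq> n"
    have n: "n \<in> {1..n}" "n \<notin> {i, j, k, l}"
      using pos ne by auto
    have en: "?e n \<in> {1..n}"
      using perms_entry[OF assms n(1)] .
    have inj: "?e n \<noteq> ?e m" if "m \<in> {i, j, k, l}" for m
    proof -
      have "m - 1 < n" "n - 1 < n" "m - 1 \<noteq> n - 1"
        using that pos ne by auto
      then show ?thesis
        using assms len by (auto simp: perms_def permutations_of_set_def nth_eq_iff_index_eq)
    qed
    \<comment> \<open>The values 1 and \<open>n\<close> are already taken at \<open>j\<close> and
      \<open>k\<close>, so the last entry lies in row 1, 2 or 3 of the shaded column 4.\<close>
    have "?e j < ?e n" "?e n < ?e k"
      using inj[of j] inj[of k] en unfolding ej ek by auto
    then consider "?e j < ?e n" "?e n < ?e i" | "?e i < ?e n" "?e n < ?e l" | "?e l < ?e n" "?e n < ?e k"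
      using inj[of i] inj[of l] by (metis insertCI linorder_neqE_nat)
    then obtain y where "y \<le> 4" "(0 # sort (map ?e ps) @ [n + 1]) ! y < ?e n"
        "?e n < (0 # sort (map ?e ps) @ [n + 1]) ! (y + 1)"
    proof cases
      case 1
      show ?thesis by (rule that[of 1], unfold sorted) (use 1 in simp_all)
    next
      case 2
      show ?thesis by (rule that[of 2], unfold sorted) (use 2 in simp_all)
    next
      case 3
      show ?thesis by (rule that[of 3], unfold sorted) (use 3 in simp_all)
    qed
    moreover from this have "(4, y) \<in> snd p2143"
      by (auto simp: p2143_def)
    ultimately show False
      using mesh[of 4 y n] pos ne by (auto simp: ps)
  qed
  with pos ej ek vals show ?R
    by (intro exI[of _ i] exI[of _ j] exI[of _ k]) simp
next
  assume ?R
  then obtain i j k where pos: "1 \<le> i" "i < j" "j < k" "k < n"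
    and e: "entry \<tau> j = 1" "entry \<tau> k = n" "1 < entry \<tau> i" "entry \<tau> i < entry \<tau> n" "entry \<tau> n < n"
    by blast
  have len: "length \<tau> = n"
    using assms by (rule perms_length)
  have sorted: "sort (map (entry \<tau>) [i, j, k, n]) = [1, entry \<tau> i, entry \<tau> n, n]"
    unfolding list.map e(1,2) using e(3-5) by (rule sort_2143)
  have ord: "map (entry \<tau>) [i, j, k, n] ! a < map (entry \<tau>) [i, j, k, n] ! b \<longleftrightarrow>
       [2,1,4,3::nat] ! a < [2,1,4,3] ! b" if "a < 4" "b < 4" for a b
  proof -
    have "a \<in> {0,1,2,3}" "b \<in> {0,1,2,3}"
      using that by auto
    then show ?thesis
      unfolding list.map e(1,2) using e(3-5) by (elim insertE emptyE) simp_all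
  qed
  \<comment> \<open>The shading conditions are vacuous: no natural number lies strictly between 0
    and 1, or between \<open>n\<close> and \<open>n + 1\<close>, be it a value or a
    position.\<close>
  have "is_occurrence p2143 \<tau> [i, j, k, n]"
    unfolding is_occurrence_def p2143_def Let_def prod.case len sorted
    using ord pos e(5) by (auto simp del: list.map One_nat_def)
  then show "contains \<tau> p2143"
    unfolding contains_def by blast
qed

section \<open>Splitting off the last entry and counting the remaining arrangements\<close>

lemma perms_snocI:
  assumes "b \<in> {1..n}" "xs \<in> permutations_of_set ({1..n} - {b})"
  shows "xs @ [b] \<in> perms n"
proof -
  have xs: "set xs = {1..n} - {b}" "distinct xs"
    using assms by (auto simp: permutations_of_set_def)
  have "set (xs @ [b]) = {1..n}"
    unfolding set_append xs(1) using assms(1) by auto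
  moreover have "distinct (xs @ [b])"
    using xs by simp
  ultimately show ?thesis
    unfolding perms_def by (rule permutations_of_setI)
qed

text \<open>The first condition on \<open>xs\<close> places 1 before \<open>n\<close>. Given that,
  the second can only hold because some value in \<open>{2..<b}\<close> precedes 1, and this value
  plays the role of the pattern entry 2.\<close>

lemma contains_p2143_snoc:
  assumes "b \<in> {1..n}" "xs \<in> permutations_of_set ({1..n} - {b})"
  shows "contains (xs @ [b]) p2143 \<longleftrightarrow>
    b \<in> {2..<n} \<and> first_among {1, n} 1 xs \<and> \<not> first_among (insert n {1..<b}) 1 xs"
proof -
  have xs: "set xs = {1..n} - {b}" "distinct xs"
    using assms by (auto simp: permutations_of_set_def)
  then have len: "length xs = n - 1"
    using assms by (simp add: distinct_card[symmetric])
  have "xs @ [b] \<in> perms n"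
    using assms by (rule perms_snocI)
  note iff = contains_p2143_iff[OF this]
  have last: "entry (xs @ [b]) n = b"
    by (simp add: len nth_append)
  have nth: "entry (xs @ [b]) i = xs ! (i - 1)" if "1 \<le> i" "i < n" for i
    using that diff_less_mono[of i n 1] by (simp add: nth_append len)
  show ?thesis
  proof
    assume "contains (xs @ [b]) p2143"
    then obtain i j k where pos: "1 \<le> i" "i < j" "j < k" "k < n"
      and e': "entry (xs @ [b]) j = 1" "entry (xs @ [b]) k = n" "1 < entry (xs @ [b]) i"
        "entry (xs @ [b]) i < entry (xs @ [b]) n" "entry (xs @ [b]) n < n"
      unfolding iff by blast
    have "1 \<le> j" "j < n" "1 \<le> k" "i < n"
      using pos by linarith+
    note nths = nth[OF pos(1) this(4)] nth[OF this(1,2)] nth[OF this(3) pos(4)]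
    have e: "xs ! (j - 1) = 1" "xs ! (k - 1) = n" "1 < xs ! (i - 1)" "xs ! (i - 1) < b" "b < n"
      using e' unfolding nths last by blast+
    \<comment> \<open>Entries are distinct, so any index witnessing \<open>first_among\<close> for 1
      must be \<open>j - 1\<close>, the 0-based form of position \<open>j\<close>.\<close>
    have uniq: "i' = j - 1" if "i' < length xs" "xs ! i' = 1" for i'
      using that e(1) pos len nth_eq_iff_index_eq[OF xs(2), of i' "j - 1"] by linarith
    have uniq': "i' = k - 1" if "i' < length xs" "xs ! i' = n" for i'
      using that e(2) pos len nth_eq_iff_index_eq[OF xs(2), of i' "k - 1"] by linarith
    have "xs ! m \<notin> {1, n}" if "m < j - 1" for m
    proof -
      have "m < length xs" "m \<noteq> j - 1" "m \<noteq> k - 1"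
        using that pos len by linarith+
      then show ?thesis
        using uniq[of m] uniq'[of m] by blast
    qed
    moreover have j: "j - 1 < length xs" "i - 1 < j - 1"
      using pos len by linarith+
    ultimately have "first_among {1, n} 1 xs"
      unfolding first_among_def using e(1) by blast
    moreover have "\<not> first_among (insert n {1..<b}) 1 xs"
    proof
      assume "first_among (insert n {1..<b}) 1 xs"
      then obtain m where m: "m < length xs" "xs ! m = 1" "\<forall>j<m. xs ! j \<notin> insert n {1..<b}"
        unfolding first_among_def by blast
      then have "xs ! (i - 1) \<notin> {1..<b}"
        using uniq[OF m(1,2)] j(2) by blast
      then show False
        using e(3,4) by simp
    qed
    moreover have "b \<in> {2..<n}"
      using e(3-5) by simp
    ultimately show "b \<in> {2..<n} \<and> first_among {1, n} 1 xs \<and> \<not> first_among (insert n {1..<b}) 1 xs"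
      by blast
  next
    assume R: "b \<in> {2..<n} \<and> first_among {1, n} 1 xs \<and> \<not> first_among (insert n {1..<b}) 1 xs"
    then obtain j where j: "j < length xs" "xs ! j = 1" "\<forall>i<j. xs ! i \<notin> {1, n}"
      unfolding first_among_def by blast
    \<comment> \<open>The index \<open>j\<close> cannot witness the larger set, so something before
      it lies in that set; being neither 1 nor \<open>n\<close>, it is a value strictly between 1
      and \<open>b\<close>.\<close>
    with R obtain i where i: "i < j" "xs ! i \<in> insert n {1..<b}"
      unfolding first_among_def by blast
    have "xs ! i \<noteq> 1" "xs ! i \<noteq> n"
      using i(1) j(3) by blast+
    with i(2) have i': "1 < xs ! i" "xs ! i < b"
      by simp_all
    have b: "1 < n" "b < n"
      using R by simp_all
    then have "n \<in> set xs"
      unfolding xs(1) by simp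
    then obtain k where k: "k < length xs" "xs ! k = n"
      unfolding in_set_conv_nth by blast
    have "\<not> k < j" "k \<noteq> j"
      using j(2,3) k(2) b(1) by auto
    then have pos: "1 \<le> Suc i" "Suc i < Suc j" "Suc j < Suc k" "Suc k < n"
      using i(1) k(1) len by linarith+
    moreover have "entry (xs @ [b]) (Suc j) = 1" "entry (xs @ [b]) (Suc k) = n" "entry (xs @ [b]) (Suc i) = xs ! i"
      using nth[of "Suc i"] nth[of "Suc j"] nth[of "Suc k"] pos j(2) k(2) by simp_all
    ultimately show "contains (xs @ [b]) p2143"
      unfolding iff using i' b(2) last by metis
  qed
qed

text \<open>The good arrangements form a difference of nested sets, of sizes
  \<open>(n - 1)! / 2\<close> and \<open>(n - 1)! / b\<close>, as \<open>insert n {1..<b}\<close>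
  has \<open>b\<close> elements. For \<open>b = 2\<close> the two sets coincide.\<close>

lemma card_contains_snoc:
  assumes "b \<in> {2..<n}"
  shows "real (card {xs \<in> permutations_of_set ({1..n} - {b}). contains (xs @ [b]) p2143})
           = fact (n - 1) * (1 / 2 - 1 / real b)"
proof -
  let ?A = "{1..n} - {b}"
  let ?F = "\<lambda>B. {xs \<in> permutations_of_set ?A. first_among B 1 xs}"
  let ?B = "insert n {1..<b}"
  have A: "card ?A = n - 1"
    using assms by simp
  have cB: "card ?B = b" "card {1, n} = 2"
    using assms by auto
  have "2 * card (?F {1, n}) = fact (n - 1)"
    using card_first_among[of ?A "{1, n}" 1] assms A cB by auto
  then have c1: "real (card (?F {1, n})) = fact (n - 1) / 2"
    by (metis (mono_tags) nonzero_mult_div_cancel_left of_nat_fact of_nat_mult of_nat_numeral zero_neq_numeral)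
  have "b * card (?F ?B) = fact (n - 1)"
    using card_first_among[of ?A ?B 1] assms unfolding A cB by fastforce
  then have "real b * real (card (?F ?B)) = fact (n - 1)"
    by (metis of_nat_fact of_nat_mult)
  then have c2: "real (card (?F ?B)) = fact (n - 1) / real b"
    using assms by (simp add: field_simps)
  have sub: "?F ?B \<subseteq> ?F {1, n}"
    using assms by (auto elim: first_among_mono)
  have "{xs \<in> permutations_of_set ?A. contains (xs @ [b]) p2143} = ?F {1, n} - ?F ?B"
    using contains_p2143_snoc[of b n] assms by auto
  then have "real (card {xs \<in> permutations_of_set ?A. contains (xs @ [b]) p2143})
      = real (card (?F {1, n})) - real (card (?F ?B))"
    using sub by (simp add: card_Diff_subset card_mono of_nat_diff)
  then show ?thesis
    unfolding c1 c2 by (simp add: right_diff_distrib)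
qed

lemma s_plus_p2143:
  assumes "n \<ge> 1"
  shows "real (s_plus n p2143) = fact (n - 1) * (\<Sum>b = 2..<n. 1 / 2 - 1 / real b)"
proof -
  let ?G = "\<lambda>b. {xs \<in> permutations_of_set ({1..n} - {b}). contains (xs @ [b]) p2143}"
  \<comment> \<open>Permutations are sorted by their last entry \<open>b\<close>; the values 1 and
    \<open>n\<close> for \<open>b\<close> contribute nothing.\<close>
  have eq: "{\<tau> \<in> perms n. contains \<tau> p2143} = (\<Union>b\<in>{2..<n}. (\<lambda>xs. xs @ [b]) ` ?G b)"
  proof (intro equalityI subsetI)
    fix \<tau> assume t: "\<tau> \<in> {\<tau> \<in> perms n. contains \<tau> p2143}"
    then have "length \<tau> = n" "distinct \<tau>" "set \<tau> = {1..n}"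
      by (auto simp: perms_length perms_def permutations_of_set_def)
    moreover from this assms obtain xs b where "\<tau> = xs @ [b]"
      by (metis append_butlast_last_id list.size(3) not_one_le_zero)
    ultimately have "\<tau> = xs @ [b]" "b \<in> {1..n}" "xs \<in> permutations_of_set ({1..n} - {b})"
      by (auto simp: permutations_of_set_def)
    then show "\<tau> \<in> (\<Union>b\<in>{2..<n}. (\<lambda>xs. xs @ [b]) ` ?G b)"
      using t contains_p2143_snoc[of b n xs] by auto
  next
    fix \<tau> assume "\<tau> \<in> (\<Union>b\<in>{2..<n}. (\<lambda>xs. xs @ [b]) ` ?G b)"
    then obtain b xs where "b \<in> {2..<n}" "xs \<in> ?G b" "\<tau> = xs @ [b]"
      by blast
    then show "\<tau> \<in> {\<tau> \<in> perms n. contains \<tau> p2143}"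
      using perms_snocI[of b n xs] by simp
  qed
  have "s_plus n p2143 = (\<Sum>b = 2..<n. card ((\<lambda>xs. xs @ [b]) ` ?G b))"
    unfolding s_plus_def eq by (intro card_UN_disjoint) auto
  also have "\<dots> = (\<Sum>b = 2..<n. card (?G b))"
    by (intro sum.cong refl card_image) (auto intro: inj_onI)
  finally have "real (s_plus n p2143) = (\<Sum>b = 2..<n. real (card (?G b)))"
    by simp
  also have "\<dots> = (\<Sum>b = 2..<n. fact (n - 1) * (1 / 2 - 1 / real b))"
    by (intro sum.cong refl card_contains_snoc)
  finally show ?thesis
    by (simp only: sum_distrib_left)
qed

section \<open>Harmonic sums, the closed formula and the limit\<close>

text \<open>The reciprocals sum to \<open>harm (n - 1) - 1\<close>; the missing term 1 makes up for
  having only \<open>n - 2\<close> summands 1/2.\<close>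

lemma sum_eq_harm:
  assumes "n \<ge> 2"
  shows "(\<Sum>b = 2..<n. 1 / 2 - 1 / real b) = real n / 2 - harm (n - 1)"
  using assms
proof (induction n rule: dec_induct)
  case base
  then show ?case by (simp add: harm_def)
next
  case (step n)
  then obtain m where "n = Suc m" "m \<ge> 1"
    by (cases n) auto
  with step show ?case
    by (simp add: harm_Suc inverse_eq_divide add_divide_distrib del: One_nat_def)
qed

text \<open>\<open>harm n - ln n\<close> converges to the Euler-Mascheroni constant, and
  \<open>ln n / n\<close> vanishes in the limit.\<close>

lemma harm_over_n_tendsto_0: "(\<lambda>n. harm n / real n) \<longlonglongrightarrow> 0"
proof -
  have "(\<lambda>n. (harm n - ln (real n)) * (1 / real n) + ln (real n) / real n) \<longlonglongrightarrow> euler_mascheroni * 0 + 0"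
    by (intro tendsto_add tendsto_mult euler_mascheroni_LIMSEQ lim_1_over_n lim_ln_over_n)
  then show ?thesis
    by (simp add: add_divide_distrib[symmetric])
qed

theorem theorem4p7:
  shows "(\<forall>n::nat. n \<ge> 4 \<longrightarrow>
            real (s_plus n p2143) =
              fact (n - 2) * ((real n - 2) * (real n - 3) / 2
                              - (\<Sum>k = 2..n - 2. (real n - real k - 1) / real k)))
         \<and> (\<lambda>n. real (s_plus n p2143) / fact n) \<longlonglongrightarrow> 1 / 2"
proof (intro conjI allI impI)
  fix n :: nat assume n: "n \<ge> 4"
  have fct: "fact (n - 1) = (real n - 1) * fact (n - 2)"
    using n fact_reduce[of "n - 1", where 'a = real] by (simp add: of_nat_diff numeral_2_eq_2)
  \<comment> \<open>Each summand is \<open>(n - 1) / k - 1\<close>, and there are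
    \<open>n - 3\<close> of them.\<close>
  have "(\<Sum>k = 2..n - 2. (real n - real k - 1) / real k) = (\<Sum>k = 2..n - 2. (real n - 1) / real k - 1)"
    by (intro sum.cong) (auto simp: field_simps)
  also have "\<dots> = (real n - 1) * (\<Sum>k = 2..n - 2. 1 / real k) - (real n - 3)"
    using n by (simp add: sum_subtractf sum_distrib_left of_nat_diff)
  finally have R: "(\<Sum>k = 2..n - 2. (real n - real k - 1) / real k)
      = (real n - 1) * (\<Sum>k = 2..n - 2. 1 / real k) - (real n - 3)" .
  \<comment> \<open>The count sums up to \<open>n - 1\<close>, the target only up to
    \<open>n - 2\<close>. The term for \<open>b = n - 1\<close> is split off; the factor
    \<open>n - 1\<close> from \<open>fct\<close> clears its denominator.\<close>
  have "{2..<n} = insert (n - 1) {2..n - 2}" "n - 1 \<notin> {2..n - 2}"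
    using n by auto
  then have "(\<Sum>b = 2..<n. 1 / 2 - 1 / real b)
      = (1 / 2 - 1 / (real n - 1)) + (\<Sum>b = 2..n - 2. 1 / 2 - 1 / real b)"
    using n by (simp add: of_nat_diff)
  also have "(\<Sum>b = 2..n - 2. 1 / 2 - 1 / real b) = (real n - 3) / 2 - (\<Sum>k = 2..n - 2. 1 / real k)"
    using n by (simp add: sum_subtractf of_nat_diff)
  finally have L: "(\<Sum>b = 2..<n. 1 / 2 - 1 / real b)
      = (1 / 2 - 1 / (real n - 1)) + ((real n - 3) / 2 - (\<Sum>k = 2..n - 2. 1 / real k))" .
  \<comment> \<open>Here \<open>x\<close> stands for \<open>n\<close> and \<open>H\<close> for the
    sum of \<open>1 / k\<close> over \<open>{2..n - 2}\<close>, which both sides now share.\<close>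
  have alg: "(x - 1) * ((1 / 2 - 1 / (x - 1)) + ((x - 3) / 2 - H))
      = (x - 2) * (x - 3) / 2 - ((x - 1) * H - (x - 3))" if "x > 1" for x H :: real
    using that by (simp add: field_simps)
  show "real (s_plus n p2143) = fact (n - 2) * ((real n - 2) * (real n - 3) / 2
                              - (\<Sum>k = 2..n - 2. (real n - real k - 1) / real k))"
    using alg[of "real n" "\<Sum>k = 2..n - 2. 1 / real k"] n s_plus_p2143[of n]
    unfolding fct L R by (simp add: mult.assoc mult.left_commute)
next
  \<comment> \<open>This is \<open>(n / 2 - harm (n - 1)) / n\<close> with
    \<open>harm (n - 1)\<close> replaced by \<open>harm n - 1 / n\<close>, so that the limit of
    \<open>harm n / n\<close> applies; the shift produces the term \<open>1 / n\<close>
    squared.\<close>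
  have "(\<lambda>n. 1 / 2 - harm n / real n + (1 / real n) * (1 / real n)) \<longlonglongrightarrow> 1 / 2 - 0 + 0 * 0"
    by (intro tendsto_intros harm_over_n_tendsto_0 lim_1_over_n)
  then have "(\<lambda>n. 1 / 2 - harm n / real n + (1 / real n) * (1 / real n)) \<longlonglongrightarrow> 1 / 2"
    by simp
  moreover have "eventually (\<lambda>n. 1 / 2 - harm n / real n + (1 / real n) * (1 / real n)
      = real (s_plus n p2143) / fact n) sequentially"
    using eventually_ge_at_top[of "2::nat"]
  proof eventually_elim
    case (elim n)
    have f: "fact n = real n * fact (n - 1)"
      using elim by (intro fact_reduce) auto
    have h: "harm n = harm (n - 1) + 1 / real n"
      using elim harm_Suc[of "n - 1", where 'a = real] by (simp add: inverse_eq_divide)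
    have "real (s_plus n p2143) = fact (n - 1) * (real n / 2 - harm (n - 1))"
      using elim s_plus_p2143[of n] sum_eq_harm[of n] by simp
    moreover have "1 / 2 - (H + 1 / x) / x + 1 / x * (1 / x) = (x / 2 - H) / x"
      if "x \<noteq> 0" for x H :: real
      using that by (simp add: field_simps)
    note this[of "real n" "harm (n - 1)"]
    ultimately show ?case
      using elim unfolding f h by simp
  qed
  ultimately show "(\<lambda>n. real (s_plus n p2143) / fact n) \<longlonglongrightarrow> 1 / 2"
    by (rule Lim_transform_eventually)
qed

end
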